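(* Let $Z_1,\dots,Z_n,Z_{n+1}=(X_{n+1},Y_{n+1})$ be an exchangeable sequence of random variables in $\mathbb{R}^{p+1}$ whose conformity scores are almost surely distinct. Suppose standard conformal prediction (conformity measure $y-\hat y(x)$) is used to construct the sequence of conformal quantiles $(y_{X_{n+1}}^{\alpha_i})_{i=0}^{K}$ on the grid $\alpha_i=i/K$, with $K<n-m+1$, and let $\tilde Q^{QM}$ be the quantile-matched predictive distribution defined in the context. If $n-m\to\infty$ and $K\to\infty$ as $n\to\infty$, then $\tilde Q^{QM}$ is an asymptotic predictive system. Furthermore, $$\sup_{u\in(0,1)}\left|\mathbb{P}\bigl(\tilde Q^{QM}(Z_1,\dots,Z_n,(X_{n+1},Y_{n+1}))\le u\bigr)-u\right|\le\frac1K+\frac{1}{n-m+1}.$$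
   Context: Write $z_i=(x_i,y_i)\in\mathbb{R}^p\times\mathbb{R}$. The first $m<n$ observations form the training set and $z_{m+1},\dots,z_n$ the calibration set, with $N:=n-m$. A point predictor $\hat y(\cdot)$ is fitted (measurably) on $z_1,\dots,z_m$ only. The conformity scores are $E_i=y_{m+i}-\hat y(x_{m+i})$, $i=1,\dots,N$, together with the test score $y_{n+1}-\hat y(x_{n+1})$; standing assumption: these are almost surely distinct. The conformal atoms are $C_i=\hat y(x_{n+1})+E_i$, sorted as $C_{(1)}\le\dots\le C_{(N)}$. Conformal quantiles: for $\alpha\in(0,1)$ with $\lceil (N+1)\alpha\rceil\le N$, $y_{x_{n+1}}^{\alpha}$ is the empirical quantile of the atoms at level $\alpha(1+1/N)$, i.e. $y_{x_{n+1}}^{\alpha}=C_{(\lceil (N+1)\alpha\rceil)}$. Let $K\ge1$ be an integer with $K<N+1$, $\alpha_i=i/K$ for $i=0,\dots,K$, with conventions $y_{x_{n+1}}^{\alpha_0}=-\infty$, $y_{x_{n+1}}^{\alpha_K}=+\infty$. The quantile-matched predictive distribution is $$\tilde Q^{QM}(z_1,\dots,z_n,(x_{n+1},y))=\begin{cases}\inf\{\alpha_i:\ y<y_{x_{n+1}}^{\alpha_i}\}&\text{if }y\ge C_{(1)},\\ 0&\text{if }y<C_{(1)}.\end{cases}$$ A function $Q:(\mathbb{R}^{p+1})^{n+1}\to[0,1]$ (a family indexed by $n$), right-continuous in $y$, is an asymptotic predictive system if: (1) for fixed $z_1,\dots,z_n,x_{n+1}$, $Q(z_1,\dots,z_n,(x_{n+1},y))$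 is non-decreasing in $y$; (2) for all $z_1,\dots,z_n,x_{n+1}$ it tends to $0$ as $y\to-\infty$ and to $1$ as $y\to\infty$; (3) for any exchangeable sequence $Z_1,\dots,Z_{n+1}$ in $\mathbb{R}^{p+1}$ (here, under the standing assumption of almost surely distinct scores), $Q(Z_1,\dots,Z_{n+1})$ converges in distribution to $\mathrm{Unif}[0,1]$ as $n\to\infty$. *)

theory Defs
  imports "HOL-Probability.Probability"
begin

text \<open>
  Sequences are indexed from 1. A sample \<open>(z_1, \<dots>, z_k)\<close> is an element of
  \<^term>\<open>{1..k} \<rightarrow>\<^sub>E UNIV\<close>, the underlying set of the product measure space
  \<^term>\<open>Pi\<^sub>M {1..k} (\<lambda>_. borel)\<close>.
\<close>

definition exchangeable :: "'w measure \<Rightarrow> nat \<Rightarrow> (nat \<Rightarrow> 'w \<Rightarrow> 'z::topological_space) \<Rightarrow> bool" where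
  "exchangeable M k Z \<longleftrightarrow>
     (\<forall>i\<in>{1..k}. Z i \<in> borel_measurable M) \<and>
     (\<forall>\<pi>. \<pi> permutes {1..k} \<longrightarrow>
        distr M (Pi\<^sub>M {1..k} (\<lambda>_. borel)) (\<lambda>\<omega>. \<lambda>i\<in>{1..k}. Z (\<pi> i) \<omega>) =
        distr M (Pi\<^sub>M {1..k} (\<lambda>_. borel)) (\<lambda>\<omega>. \<lambda>i\<in>{1..k}. Z i \<omega>))"

text \<open>
  A fitting procedure \<open>f\<close> maps a training sample to a point predictor. Below it is only ever
  applied to \<^term>\<open>restrict z {1..m}\<close>, so the predictor depends on the training set alone.
\<close>

type_synonym 'p fitting = "(nat \<Rightarrow> (real^'p) \<times> real) \<Rightarrow> real^'p \<Rightarrow> real"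

definition measurable_fitting :: "nat \<Rightarrow> 'p::finite fitting \<Rightarrow> bool" where
  "measurable_fitting m f \<longleftrightarrow>
     (\<lambda>(z, x). f z x) \<in> borel_measurable (Pi\<^sub>M {1..m} (\<lambda>_. borel) \<Otimes>\<^sub>M borel)"

definition score :: "nat \<Rightarrow> 'p::finite fitting \<Rightarrow> (nat \<Rightarrow> (real^'p) \<times> real) \<Rightarrow> nat \<Rightarrow> real" where
  "score m f z j = snd (z j) - f (restrict z {1..m}) (fst (z j))"

definition scores_distinct ::
  "nat \<Rightarrow> nat \<Rightarrow> 'p::finite fitting \<Rightarrow> 'w measure \<Rightarrow> (nat \<Rightarrow> 'w \<Rightarrow> (real^'p) \<times> real) \<Rightarrow> bool" where
  "scores_distinct n m f M Z \<longleftrightarrow>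
     (AE \<omega> in M. inj_on (score m f (\<lambda>i. Z i \<omega>)) {m+1..n+1})"

definition atoms ::
  "nat \<Rightarrow> nat \<Rightarrow> 'p::finite fitting \<Rightarrow> (nat \<Rightarrow> (real^'p) \<times> real) \<Rightarrow> real^'p \<Rightarrow> real list" where
  "atoms n m f z x =
     sort (map (\<lambda>i. f (restrict z {1..m}) x + score m f z (m + i)) [1..<n - m + 1])"

text \<open>The \<open>j\<close>-th smallest atom, for \<open>1 \<le> j \<le> n - m\<close>.\<close>

definition atom ::
  "nat \<Rightarrow> nat \<Rightarrow> 'p::finite fitting \<Rightarrow> (nat \<Rightarrow> (real^'p) \<times> real) \<Rightarrow> real^'p \<Rightarrow> nat \<Rightarrow> real" where
  "atom n m f z x j = atoms n m f z x ! (j - 1)"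

definition conformal_quantile ::
  "nat \<Rightarrow> nat \<Rightarrow> 'p::finite fitting \<Rightarrow> (nat \<Rightarrow> (real^'p) \<times> real) \<Rightarrow> real^'p \<Rightarrow> real \<Rightarrow> real" where
  "conformal_quantile n m f z x \<alpha> = atom n m f z x (nat \<lceil>real (n - m + 1) * \<alpha>\<rceil>)"

definition grid_quantile ::
  "nat \<Rightarrow> nat \<Rightarrow> nat \<Rightarrow> 'p::finite fitting \<Rightarrow> (nat \<Rightarrow> (real^'p) \<times> real) \<Rightarrow> real^'p \<Rightarrow> nat \<Rightarrow> ereal" where
  "grid_quantile n m K f z x i =
     (if i = 0 then -\<infinity> else if i = K then \<infinity>
      else ereal (conformal_quantile n m f z x (real i / real K)))"

definition quantile_matched ::
  "nat \<Rightarrow> nat \<Rightarrow> nat \<Rightarrow> 'p::finite fitting \<Rightarrow>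
     (nat \<Rightarrow> (real^'p) \<times> real) \<Rightarrow> real^'p \<Rightarrow> real \<Rightarrow> real" where
  "quantile_matched n m K f z x y =
     (if y \<ge> atom n m f z x 1
      then Inf {real i / real K | i. i \<le> K \<and> ereal y < grid_quantile n m K f z x i}
      else 0)"

definition eval_at ::
  "nat \<Rightarrow> ((nat \<Rightarrow> 'a \<times> real) \<Rightarrow> 'a \<Rightarrow> real \<Rightarrow> real) \<Rightarrow> (nat \<Rightarrow> 'a \<times> real) \<Rightarrow> real" where
  "eval_at n q z = q (restrict z {1..n}) (fst (z (n + 1))) (snd (z (n + 1)))"

text \<open>
  \<open>D n M Z\<close> is the standing assumption on the sequence of length \<open>n + 1\<close> under which uniformity
  is required. The exchangeable sequence and its probability space may change with \<open>n\<close>; a single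
  infinite exchangeable sequence is the case of constant \<open>M\<close> and \<open>Z\<close>. Sample spaces have the
  type \<^typ>\<open>'w\<close>, to be left universally quantified in theorems. The family is indexed by
  \<open>n \<ge> 1\<close>. Convergence in distribution includes that the values are random variables, since
  \<^const>\<open>distr\<close> is meaningful only for measurable maps.
\<close>

definition asymptotic_predictive_system ::
  "(nat \<Rightarrow> 'w measure \<Rightarrow> (nat \<Rightarrow> 'w \<Rightarrow> (real^'p::finite) \<times> real) \<Rightarrow> bool) \<Rightarrow>
   (nat \<Rightarrow> (nat \<Rightarrow> (real^'p) \<times> real) \<Rightarrow> real^'p \<Rightarrow> real \<Rightarrow> real) \<Rightarrow> bool" where
  "asymptotic_predictive_system D Q \<longleftrightarrow>
     (\<forall>n\<ge>1. \<forall>z\<in>{1..n} \<rightarrow>\<^sub>E UNIV. \<forall>x.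
        range (Q n z x) \<subseteq> {0..1} \<and>
        (\<forall>y. continuous (at_right y) (Q n z x)) \<and>
        mono (Q n z x) \<and>
        (Q n z x \<longlongrightarrow> 0) at_bot \<and>
        (Q n z x \<longlongrightarrow> 1) at_top) \<and>
     (\<forall>(M :: nat \<Rightarrow> 'w measure) Z.
        (\<forall>n\<ge>1. prob_space (M n) \<and> exchangeable (M n) (n + 1) (Z n) \<and> D n (M n) (Z n)) \<longrightarrow>
        (\<forall>n\<ge>1. (\<lambda>\<omega>. eval_at n (Q n) (\<lambda>i. Z n i \<omega>)) \<in> borel_measurable (M n)) \<and>
        weak_conv_m (\<lambda>n. distr (M n) borel (\<lambda>\<omega>. eval_at n (Q n) (\<lambda>i. Z n i \<omega>)))
          (uniform_measure lborel {0..1}))"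

end

theory Submission
  imports Defs
begin

text \<open>
  Put \<open>N = n - m\<close> and let \<open>R\<close> be the number of calibration scores that are at most the test score.
  Comparing the test response with the sorted atoms shows that the quantile-matched value is the
  deterministic function \<open>(\<lfloor>R K / (N + 1)\<rfloor> + 1) / K\<close> of \<open>R\<close> (and \<open>0\<close> if \<open>R = 0\<close>), so
  that it is at most \<open>u\<close> iff \<open>R + 1 \<le> max 1 \<lceil>\<lfloor>u K\<rfloor> (N + 1) / K\<rceil>\<close>. Swapping the test point with a
  calibration point leaves the fitted predictor unchanged, hence by exchangeability \<open>R + 1\<close> is
  uniform on \<open>{1..N + 1}\<close>. The two roundings cost at most \<open>1 / K\<close> and \<open>1 / (N + 1)\<close>.
\<close>

section \<open>Order statistics and ranks in finite sets\<close>

text \<open>The entries that are at most \<open>y\<close> form an initial segment of a sorted list,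
  so a zero-based position lies in it exactly when it is below its length.\<close>

lemma sorted_nth_le_iff:
  fixes xs :: "'a::linorder list"
  assumes "sorted xs" "j < length xs"
  shows "xs ! j \<le> y \<longleftrightarrow> j < length (filter (\<lambda>x. x \<le> y) xs)"
  using assms
proof (induction xs arbitrary: j)
  case Nil
  then show ?case by simp
next
  case (Cons a xs)
  show ?case
  proof (cases "a \<le> y")
    case True
    with Cons show ?thesis by (cases j) auto
  next
    case False
    then have "filter (\<lambda>x. x \<le> y) (a # xs) = []"
      using Cons.prems by (auto simp: filter_empty_conv)
    moreover have "\<not> (a # xs) ! j \<le> y"
      using False Cons.prems by (cases j) (auto dest!: nth_mem)
    ultimately show ?thesis by simp
  qed
qed

text \<open>Distinct scores make the rank a bijection from \<open>A\<close> onto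
  \<open>{1..card A}\<close>. This is the deterministic core of the uniformity of the test
  rank.\<close>

lemma card_rank_le:
  fixes s :: "'a \<Rightarrow> 'b::linorder"
  assumes "finite A" "inj_on s A" "t \<le> card A"
  shows "card {j\<in>A. card {i\<in>A. s i \<le> s j} \<le> t} = t"
proof -
  define r where "r j = card {i\<in>A. s i \<le> s j}" for j
  have less: "r i < r j" if "i \<in> A" "j \<in> A" "s i < s j" for i j
  proof -
    have "j \<in> {k\<in>A. s k \<le> s j} - {k\<in>A. s k \<le> s i}" using that by auto
    moreover have "{k\<in>A. s k \<le> s i} \<subseteq> {k\<in>A. s k \<le> s j}" using that by auto
    ultimately show ?thesis unfolding r_def using assms(1) by (intro psubset_card_mono) auto
  qed
  have inj: "inj_on r A"
  proof (rule inj_onI)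
    fix i j assume ij: "i \<in> A" "j \<in> A" "r i = r j"
    then have "s i = s j"
      using less[of i j] less[of j i] by (metis less_irrefl linorder_neqE)
    with ij assms(2) show "i = j" by (auto dest: inj_onD)
  qed
  \<comment> \<open>Both sets have the same size by injectivity, so one inclusion suffices; a rank
    is at least 1 because each element counts itself.\<close>
  have "r ` A = {1..card A}"
  proof (rule card_subset_eq)
    show "r ` A \<subseteq> {1..card A}"
    proof
      fix k assume "k \<in> r ` A"
      then obtain j where j: "j \<in> A" "k = r j" by blast
      then have "{i\<in>A. s i \<le> s j} \<noteq> {}" by auto
      then have "0 < r j" unfolding r_def using assms(1) by (simp add: card_gt_0_iff)
      moreover have "r j \<le> card A" unfolding r_def by (intro card_mono assms(1)) auto
      ultimately show "k \<in> {1..card A}" using j by simp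
    qed
  qed (simp_all add: card_image inj)
  moreover have "r ` {j\<in>A. r j \<le> t} = {k \<in> r ` A. k \<le> t}"
    by blast
  ultimately have "r ` {j\<in>A. r j \<le> t} = {1..t}"
    using assms(3) by auto
  moreover have "inj_on r {j\<in>A. r j \<le> t}"
    using inj by (rule inj_on_subset) auto
  ultimately show ?thesis
    unfolding r_def[symmetric] using card_image[of r "{j\<in>A. r j \<le> t}"] by simp
qed

section \<open>The matched level as a function of the rank\<close>

text \<open>The quantile-matched value when \<open>R\<close> of the \<open>N\<close> atoms lie at or below the response.\<close>

definition matched_level :: "nat \<Rightarrow> nat \<Rightarrow> nat \<Rightarrow> real" where
  "matched_level N K R = (if R = 0 then 0 else real (R * K div (N + 1) + 1) / real K)"

lemma matched_level_mono: "R \<le> R' \<Longrightarrow> matched_level N K R \<le> matched_level N K R'"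
  by (auto simp: matched_level_def intro!: divide_right_mono div_le_mono)

text \<open>\<open>N * K = (K - 1) * (N + 1) + (N + 1 - K)\<close>, whose last term is a valid
  remainder, so the quotient is \<open>K - 1\<close>. This gives the limit 1 at the right end and
  the upper bound on all levels.\<close>

lemma matched_level_max:
  assumes "1 \<le> N" "1 \<le> K" "K \<le> N"
  shows "matched_level N K N = 1"
proof -
  obtain k where k: "K = Suc k" using assms by (cases K) auto
  have "N * K div (N + 1) = k"
    by (rule div_nat_eqI) (use assms k in \<open>auto simp: algebra_simps\<close>)
  with assms k show ?thesis by (simp add: matched_level_def)
qed

lemma matched_level_nonneg: "0 \<le> matched_level N K R"
  by (simp add: matched_level_def)

text \<open>Turns a value of the distribution function into a rank count: once the rank is known to
  be uniform, \<open>t / (N + 1)\<close> is the probability to be compared with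
  \<open>u\<close>.\<close>

lemma matched_level_le_iff:
  assumes "1 \<le> K" "0 \<le> u" "u \<le> 1"
  obtains t where "t \<le> N + 1"
    "\<And>R. matched_level N K R \<le> u \<longleftrightarrow> R + 1 \<le> t"
    "\<bar>real t / real (N + 1) - u\<bar> \<le> 1 / real K + 1 / real (N + 1)"
proof -
  \<comment> \<open>\<open>k\<close> is the largest grid index with \<open>k / K\<close> at most
    \<open>u\<close>, and \<open>c\<close> is the number of \<open>R\<close> with
    \<open>R * K div (N + 1) < k\<close>.\<close>
  define k where "k = nat \<lfloor>u * real K\<rfloor>"
  define c where "c = nat \<lceil>real k * real (N + 1) / real K\<rceil>"
  have Kpos: "real K > 0" using assms by simp
  have k_le: "real k \<le> u * real K" unfolding k_def using assms by simp
  have k_gt: "u * real K < real k + 1" unfolding k_def using assms by linarith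
  have k_iff: "real (q + 1) \<le> u * real K \<longleftrightarrow> q < k" for q
  proof -
    have "real (q + 1) \<le> u * real K \<longleftrightarrow> q + 1 \<le> k"
      using k_le k_gt by (metis (mono_tags) Suc_eq_plus1 less_Suc_eq_le not_le of_nat_1 of_nat_add of_nat_less_iff order_le_less_trans order_less_le_trans)
    then show ?thesis by (simp add: Suc_le_eq)
  qed
  have c_iff: "R < c \<longleftrightarrow> R * K < k * (N + 1)" for R
  proof -
    have "R < c \<longleftrightarrow> real R < real k * real (N + 1) / real K"
      unfolding c_def by (simp add: zless_nat_eq_int_zless less_ceiling_iff)
    also have "\<dots> \<longleftrightarrow> real (R * K) < real (k * (N + 1))"
      using Kpos by (simp add: pos_less_divide_eq algebra_simps)
    finally show ?thesis by (simp only: of_nat_less_iff)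
  qed
  have kK: "k \<le> K"
  proof -
    have "u * real K \<le> 1 * real K" using assms by (intro mult_right_mono) auto
    with k_le show ?thesis by linarith
  qed
  have c_ge: "real c \<ge> real k * real (N + 1) / real K" unfolding c_def by linarith
  have c_lt: "real c < real k * real (N + 1) / real K + 1"
  proof -
    have "0 \<le> real k * real (N + 1) / real K" by simp
    then show ?thesis unfolding c_def by linarith
  qed
  \<comment> \<open>The threshold is \<open>max 1 c\<close>: for \<open>R = 0\<close> the level is 0
    by definition instead of \<open>1 / K\<close>, so this value of \<open>R\<close> counts even if
    \<open>c = 0\<close>.\<close>
  show ?thesis
  proof
    have "real k * real (N + 1) / real K \<le> real (N + 1)"
      using kK Kpos by (simp add: pos_divide_le_eq mult.commute mult_left_mono)
    then have "\<lceil>real k * real (N + 1) / real K\<rceil> \<le> int (N + 1)"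
      by (simp only: ceiling_le_iff of_int_of_nat_eq)
    then have "c \<le> N + 1" unfolding c_def by (simp only: nat_le_iff)
    then show "max 1 c \<le> N + 1" by simp
  next
    fix R
    show "matched_level N K R \<le> u \<longleftrightarrow> R + 1 \<le> max 1 c"
    proof (cases "R = 0")
      case True
      with assms show ?thesis by (simp add: matched_level_def)
    next
      case False
      then have "matched_level N K R \<le> u \<longleftrightarrow> real (R * K div (N + 1) + 1) \<le> u * real K"
        using Kpos by (simp add: matched_level_def pos_divide_le_eq)
      also have "\<dots> \<longleftrightarrow> R * K div (N + 1) < k" by (rule k_iff)
      also have "\<dots> \<longleftrightarrow> R < c" by (simp add: c_iff div_less_iff_less_mult)
      finally show ?thesis using False by auto
    qed
  next
    \<comment> \<open>Rounding \<open>u\<close> down to the grid loses at most \<open>1 / K\<close>;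
      rounding up to a rank gains at most \<open>1 / (N + 1)\<close>. The errors have opposite
      signs, and their sum bounds both.\<close>
    have lo: "u - 1 / real K \<le> real k / real K"
    proof -
      have "u \<le> (real k + 1) / real K" using k_gt Kpos by (simp add: pos_le_divide_eq)
      then show ?thesis by (simp add: add_divide_distrib)
    qed
    have hi: "real k / real K \<le> u"
      using k_le Kpos by (simp add: pos_divide_le_eq)
    have "real k / real K \<le> real c / real (N + 1)"
      using c_ge Kpos by (simp add: field_simps)
    moreover have "real c / real (N + 1) \<le> real k / real K + 1 / real (N + 1)"
    proof -
      have "real c / real (N + 1) \<le> (real k * real (N + 1) / real K + 1) / real (N + 1)"
        using c_lt by (intro divide_right_mono) auto
      also have "\<dots> = real k / real K + 1 / real (N + 1)"
        by (subst add_divide_distrib) simp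
      finally show ?thesis .
    qed
    moreover have "real (max 1 c) / real (N + 1) = max (1 / real (N + 1)) (real c / real (N + 1))"
      by (auto simp: max_def divide_le_cancel)
    moreover have "0 < 1 / real (N + 1)" "0 < 1 / real K" using Kpos by auto
    ultimately show "\<bar>real (max 1 c) / real (N + 1) - u\<bar> \<le> 1 / real K + 1 / real (N + 1)"
      using lo hi assms(2) by linarith
  qed
qed

section \<open>Atoms and grid quantiles in terms of the rank\<close>

text \<open>This is \<open>R\<close> of the overview. Indices run over sample positions, not over
  the shifted positions in \<open>atoms\<close>, so that they agree with the indices of the
  scores.\<close>

definition atom_rank ::
  "nat \<Rightarrow> nat \<Rightarrow> 'p::finite fitting \<Rightarrow> (nat \<Rightarrow> (real^'p) \<times> real) \<Rightarrow> real^'p \<Rightarrow> real \<Rightarrow> nat" where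
  "atom_rank n m f z x y =
     card {i\<in>{m+1..n}. f (restrict z {1..m}) x + score m f z i \<le> y}"

lemma atom_rank_le: "atom_rank n m f z x y \<le> n - m"
proof -
  have "atom_rank n m f z x y \<le> card {m+1..n}"
    unfolding atom_rank_def by (intro card_mono) auto
  also have "\<dots> = n - m" unfolding card_atLeastAtMost by arith
  finally show ?thesis .
qed

text \<open>Sorting does not change how many atoms are at most \<open>y\<close>, so the order
  statistics can be replaced by a count over unsorted indices.\<close>

lemma atom_le_iff:
  assumes "1 \<le> j" "j \<le> n - m"
  shows "atom n m f z x j \<le> y \<longleftrightarrow> j \<le> atom_rank n m f z x y"
proof -
  let ?g = "\<lambda>i. f (restrict z {1..m}) x + score m f z (m + i)"
  let ?I = "{i\<in>{1..n-m}. ?g i \<le> y}"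
  have "atom n m f z x j \<le> y \<longleftrightarrow> j - 1 < length (filter (\<lambda>x. x \<le> y) (atoms n m f z x))"
    unfolding atom_def using assms by (intro sorted_nth_le_iff) (auto simp: atoms_def simp del: upt_Suc)
  also have "length (filter (\<lambda>x. x \<le> y) (atoms n m f z x)) =
      length (filter (\<lambda>i. ?g i \<le> y) [1..<n - m + 1])"
    by (simp add: atoms_def filter_sort filter_map o_def del: upt_Suc)
  also have "\<dots> = card (set (filter (\<lambda>i. ?g i \<le> y) [1..<n - m + 1]))"
    by (intro distinct_card[symmetric]) simp
  also have "set (filter (\<lambda>i. ?g i \<le> y) [1..<n - m + 1]) = ?I"
    by auto
  also have "card ?I = card ((+) m ` ?I)"
    by (simp add: card_image)
  also have "(+) m ` ?I = {i\<in>{m+1..n}. f (restrict z {1..m}) x + score m f z i \<le> y}"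
  proof (intro equalityI subsetI)
    fix i assume "i \<in> {i\<in>{m+1..n}. f (restrict z {1..m}) x + score m f z i \<le> y}"
    then show "i \<in> (+) m ` ?I" by (intro image_eqI[of _ _ "i - m"]) auto
  qed auto
  finally show ?thesis using assms unfolding atom_rank_def by linarith
qed

text \<open>The conventions at both ends obey the same inequality: it fails for \<open>i = 0\<close>
  and holds for \<open>i = K\<close> because the rank is at most \<open>n - m\<close>. In between,
  negate \<open>atom_le_iff\<close> and remove the ceiling.\<close>

lemma less_grid_quantile_iff:
  assumes "m < n" "1 \<le> K" "K \<le> n - m" "i \<le> K"
  shows "ereal y < grid_quantile n m K f z x i \<longleftrightarrow>
    atom_rank n m f z x y * K < i * (n - m + 1)"
proof -
  let ?R = "atom_rank n m f z x y"
  consider "i = 0" | "i = K" | "0 < i" "i < K" using assms by linarith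
  then show ?thesis
  proof cases
    case 2
    have "?R * K < (n - m + 1) * K"
      using atom_rank_le[of n m f z x y] assms by (intro mult_strict_right_mono) auto
    then show ?thesis using 2 assms by (simp add: grid_quantile_def mult.commute)
  next
    case 3
    let ?a = "real (n - m + 1) * (real i / real K)"
    define j where "j = nat \<lceil>?a\<rceil>"
    have Kpos: "real K > 0" using assms by simp
    have "0 < ?a" using 3 by simp
    then have j1: "1 \<le> j" unfolding j_def by linarith
    \<comment> \<open>Keeps the index \<open>j\<close> within the list of atoms, where
      \<open>!\<close> is meaningful: \<open>i\<close> is at most \<open>K - 1\<close>, and
      \<open>(N + 1) * (K - 1)\<close> is at most \<open>N * K\<close> with
      \<open>N = n - m\<close>.\<close>
    have "(n - m + 1) * i \<le> (n - m) * K"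
    proof -
      obtain k where k: "K = Suc k" "i \<le> k" using 3 by (cases K) auto
      have "(n - m + 1) * i \<le> (n - m + 1) * k" using k by (intro mult_left_mono) auto
      also have "\<dots> \<le> (n - m) * K" using k assms by simp
      finally show ?thesis .
    qed
    then have "real ((n - m + 1) * i) \<le> real ((n - m) * K)" by (simp only: of_nat_le_iff)
    then have "?a \<le> real (n - m)"
      unfolding times_divide_eq_right of_nat_mult[symmetric] pos_divide_le_eq[OF Kpos] .
    then have j2: "j \<le> n - m" unfolding j_def by linarith
    have "ereal y < grid_quantile n m K f z x i \<longleftrightarrow> \<not> atom n m f z x j \<le> y"
      using 3 by (auto simp: grid_quantile_def conformal_quantile_def j_def)
    also have "\<dots> \<longleftrightarrow> ?R < j" unfolding atom_le_iff[OF j1 j2] by (rule not_le)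
    also have "\<dots> \<longleftrightarrow> real ?R < ?a"
      unfolding j_def by (simp add: zless_nat_eq_int_zless less_ceiling_iff)
    also have "\<dots> \<longleftrightarrow> real (?R * K) < real (i * (n - m + 1))"
      unfolding times_divide_eq_right pos_less_divide_eq[OF Kpos] of_nat_mult
      by (simp only: mult.commute)
    finally show ?thesis by (simp only: of_nat_less_iff)
  qed (simp add: grid_quantile_def)
qed

text \<open>The admissible grid indices are those from \<open>?q\<close> to \<open>K\<close>, so the
  infimum is attained at \<open>?q\<close>; the branch below the first atom is the case of rank
  0.\<close>

lemma quantile_matched_eq:
  assumes "m < n" "1 \<le> K" "K \<le> n - m"
  shows "quantile_matched n m K f z x y = matched_level (n - m) K (atom_rank n m f z x y)"
proof -
  let ?R = "atom_rank n m f z x y"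
  let ?q = "?R * K div (n - m + 1) + 1"
  have first: "atom n m f z x 1 \<le> y \<longleftrightarrow> ?R \<noteq> 0"
    using atom_le_iff[of 1 n m f z x y] assms by simp linarith
  have iff: "?R * K < i * (n - m + 1) \<longleftrightarrow> ?q \<le> i" for i
    using div_less_iff_less_mult[of "n - m + 1" "?R * K" i] by (simp add: Suc_le_eq)
  have set_eq: "{real i / real K | i. i \<le> K \<and> ereal y < grid_quantile n m K f z x i} =
      {real i / real K | i. i \<le> K \<and> ?q \<le> i}"
    using less_grid_quantile_iff[OF assms] iff by blast
  \<comment> \<open>Shows that \<open>?q\<close> itself is an admissible index, so the infimum is
    over a nonempty set.\<close>
  have "?R * K < K * (n - m + 1)"
    using atom_rank_le[of n m f z x y] assms
    by (subst mult.commute) (intro mult_strict_left_mono, auto)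
  then have "?q \<le> K" using iff by blast
  then have "Inf {real i / real K | i. i \<le> K \<and> ?q \<le> i} = real ?q / real K"
    by (intro cInf_eq_minimum) (auto intro!: divide_right_mono simp del: of_nat_Suc)
  then show ?thesis
    unfolding quantile_matched_def matched_level_def set_eq using first by simp
qed

section \<open>Monotonicity, right-continuity and limits in the response\<close>

lemma atom_rank_mono: "y \<le> y' \<Longrightarrow> atom_rank n m f z x y \<le> atom_rank n m f z x y'"
  unfolding atom_rank_def by (intro card_mono) auto

text \<open>\<open>P a\<close> is the eventual truth value of \<open>a \<le> y\<close>. Only
  finitely many atoms matter, so the count becomes constant; one argument thus serves
  \<open>at_right\<close>, \<open>at_bot\<close> and \<open>at_top\<close>.\<close>

lemma eventually_atom_rank_eq:
  assumes "\<And>a. eventually (\<lambda>y. a \<le> y \<longleftrightarrow> P a) F"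
  shows "eventually (\<lambda>y. atom_rank n m f z x y =
    card {i\<in>{m+1..n}. P (f (restrict z {1..m}) x + score m f z i)}) F"
proof -
  have "eventually (\<lambda>y. \<forall>i\<in>{m+1..n}. f (restrict z {1..m}) x + score m f z i \<le> y \<longleftrightarrow>
      P (f (restrict z {1..m}) x + score m f z i)) F"
    using assms by (intro eventually_ball_finite) auto
  then show ?thesis
    by eventually_elim (auto simp: atom_rank_def intro!: arg_cong[where f = card])
qed

text \<open>As a function of \<open>y\<close> this is a step function with finitely many jumps, so
  each limit is that of an eventually constant function.\<close>

lemma quantile_matched_predictive:
  assumes "m < n" "1 \<le> K" "K \<le> n - m"
  shows "range (quantile_matched n m K f z x) \<subseteq> {0..1}"
    and "continuous (at_right y) (quantile_matched n m K f z x)"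
    and "mono (quantile_matched n m K f z x)"
    and "(quantile_matched n m K f z x \<longlongrightarrow> 0) at_bot"
    and "(quantile_matched n m K f z x \<longlongrightarrow> 1) at_top"
proof -
  note eq = quantile_matched_eq[OF assms]
  have max: "matched_level (n - m) K (n - m) = 1"
    using assms by (intro matched_level_max) auto
  show "range (quantile_matched n m K f z x) \<subseteq> {0..1}"
  proof safe
    fix y
    have "matched_level (n - m) K (atom_rank n m f z x y) \<le> 1"
      using matched_level_mono[OF atom_rank_le, of "n - m" K n m f z x y] max by simp
    then show "quantile_matched n m K f z x y \<in> {0..1}"
      by (simp add: eq matched_level_nonneg)
  qed
  show "mono (quantile_matched n m K f z x)"
    by (auto simp: eq intro!: monoI matched_level_mono atom_rank_mono)
  have "eventually (\<lambda>y'. a \<le> y' \<longleftrightarrow> a \<le> y) (at_right y)" for a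
  proof (cases "a \<le> y")
    case True
    then show ?thesis
      by (auto simp: eventually_at_right_field intro!: exI[of _ "y + 1"])
  next
    case False
    then show ?thesis
      by (auto simp: eventually_at_right_field intro!: exI[of _ a])
  qed
  then have "eventually (\<lambda>y'. atom_rank n m f z x y' = atom_rank n m f z x y) (at_right y)"
    using eventually_atom_rank_eq[of "\<lambda>a. a \<le> y"] unfolding atom_rank_def by blast
  then have "eventually (\<lambda>y'. quantile_matched n m K f z x y' = quantile_matched n m K f z x y) (at_right y)"
    by eventually_elim (simp add: eq)
  then show "continuous (at_right y) (quantile_matched n m K f z x)"
    by (simp add: continuous_within tendsto_eventually)
  have "eventually (\<lambda>y. atom_rank n m f z x y = 0) at_bot"
    using eventually_atom_rank_eq[of "\<lambda>_. False" at_bot n m f z x]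
    by (auto simp: eventually_gt_at_bot not_le)
  then show "(quantile_matched n m K f z x \<longlongrightarrow> 0) at_bot"
    by (intro tendsto_eventually) (elim eventually_mono, simp add: eq matched_level_def)
  have "eventually (\<lambda>y. atom_rank n m f z x y = n - m) at_top"
  proof -
    have "card {i\<in>{m+1..n}. True} = n - m"
      unfolding Collect_mem_eq simp_thms card_atLeastAtMost by arith
    then show ?thesis
      using eventually_atom_rank_eq[of "\<lambda>_. True" at_top n m f z x]
      by (simp only: simp_thms eventually_ge_at_top)
  qed
  then show "(quantile_matched n m K f z x \<longlongrightarrow> 1) at_top"
    by (intro tendsto_eventually) (elim eventually_mono, simp add: eq max)
qed

section \<open>Score ranks and their measurability\<close>

text \<open>
  Unlike \<open>atom_rank\<close>, this counts \<open>j\<close> itself and is symmetric in the calibration and test indices.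
\<close>

definition score_rank ::
  "nat \<Rightarrow> nat \<Rightarrow> 'p::finite fitting \<Rightarrow> (nat \<Rightarrow> (real^'p) \<times> real) \<Rightarrow> nat \<Rightarrow> nat" where
  "score_rank n m f z j = card {i\<in>{m+1..n+1}. score m f z i \<le> score m f z j}"

lemma score_restrict:
  assumes "m \<le> k" "j \<in> {1..k}"
  shows "score m f (restrict z {1..k}) j = score m f z j"
  using assms by (simp add: score_def restrict_restrict Int_absorb1)

text \<open>Points of the product space are restricted to \<open>{1..n+1}\<close>, whereas
  \<open>\<lambda>i. Z i \<omega>\<close> is not; the rank does not see the difference.\<close>

lemma score_rank_restrict:
  assumes "m \<le> n" "j \<in> {m+1..n+1}"
  shows "score_rank n m f (restrict z {1..n+1}) j = score_rank n m f z j"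
proof -
  have "score m f (restrict z {1..n+1}) i = score m f z i" if "i \<in> {m+1..n+1}" for i
    using assms that by (intro score_restrict) auto
  with assms(2) show ?thesis
    unfolding score_rank_def by (intro arg_cong[where f = card] Collect_cong conj_cong) simp_all
qed

text \<open>Subtracting the prediction at the test point turns the comparison of atoms with the
  response into one of scores. The \<open>- 1\<close> removes the test point, which
  \<open>score_rank\<close> counts.\<close>

lemma eval_at_quantile_matched:
  assumes "m < n" "1 \<le> K" "K \<le> n - m"
  shows "eval_at n (quantile_matched n m K f) z =
    matched_level (n - m) K (score_rank n m f z (n + 1) - 1)"
proof -
  let ?C = "{i\<in>{m+1..n}. score m f z i \<le> score m f z (n + 1)}"
  have "atom_rank n m f (restrict z {1..n}) (fst (z (n + 1))) (snd (z (n + 1))) = card ?C"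
    unfolding atom_rank_def
  proof (intro arg_cong[where f = card] Collect_cong conj_cong refl)
    fix i assume "i \<in> {m+1..n}"
    then show "(f (restrict (restrict z {1..n}) {1..m}) (fst (z (n + 1))) +
        score m f (restrict z {1..n}) i \<le> snd (z (n + 1))) =
        (score m f z i \<le> score m f z (n + 1))"
      using assms by (subst score_restrict) (auto simp: restrict_restrict Int_absorb1 score_def)
  qed
  moreover have "score_rank n m f z (n + 1) = card (insert (n + 1) ?C)"
    unfolding score_rank_def using assms by (intro arg_cong[where f = card]) auto
  ultimately show ?thesis
    unfolding eval_at_def quantile_matched_eq[OF assms] by simp
qed

lemma score_measurable:
  fixes f :: "'p::finite fitting"
  assumes "measurable_fitting m f" "m \<le> k" "j \<in> {1..k}"
  shows "(\<lambda>z. score m f z j) \<in> borel_measurable (Pi\<^sub>M {1..k} (\<lambda>_. borel))"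
proof -
  let ?P = "Pi\<^sub>M {1..k} (\<lambda>_. borel) :: (nat \<Rightarrow> (real^'p) \<times> real) measure"
  \<comment> \<open>A single observation has the Borel sigma-algebra of a product type;
    \<open>borel_prod\<close> splits it so that the projections apply.\<close>
  have j: "(\<lambda>z. z j) \<in> ?P \<rightarrow>\<^sub>M borel \<Otimes>\<^sub>M borel"
    unfolding borel_prod using assms(3) by (rule measurable_component_singleton)
  have [measurable]: "(\<lambda>z. fst (z j)) \<in> borel_measurable ?P" "(\<lambda>z. snd (z j)) \<in> borel_measurable ?P"
    using measurable_compose[OF j measurable_fst] measurable_compose[OF j measurable_snd] by simp_all
  have [measurable]: "(\<lambda>z. restrict z {1..m}) \<in>
      ?P \<rightarrow>\<^sub>M Pi\<^sub>M {1..m} (\<lambda>_. borel)"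
    using assms(2) by (intro measurable_restrict_subset) auto
  have "(\<lambda>z. (restrict z {1..m}, fst (z j))) \<in>
      ?P \<rightarrow>\<^sub>M Pi\<^sub>M {1..m} (\<lambda>_. borel) \<Otimes>\<^sub>M borel"
    by measurable
  from measurable_compose[OF this, of "\<lambda>(z, x). f z x" borel]
  have [measurable]: "(\<lambda>z. f (restrict z {1..m}) (fst (z j))) \<in> borel_measurable ?P"
    using assms(1) by (simp add: measurable_fitting_def)
  show ?thesis unfolding score_def by measurable
qed

lemma score_rank_measurable:
  fixes f :: "'p::finite fitting"
  assumes "measurable_fitting m f" "m \<le> n" "j \<in> {m+1..n+1}"
  shows "(\<lambda>z. score_rank n m f z j) \<in> Pi\<^sub>M {1..n+1} (\<lambda>_. borel) \<rightarrow>\<^sub>M count_space UNIV"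
proof -
  let ?P = "Pi\<^sub>M {1..n+1} (\<lambda>_. borel) :: (nat \<Rightarrow> (real^'p) \<times> real) measure"
  have score: "(\<lambda>z. score m f z i) \<in> borel_measurable ?P" if "i \<in> {m+1..n+1}" for i
    using assms that by (intro score_measurable) auto
  have "{z\<in>space ?P. i \<in> {i\<in>{m+1..n+1}. score m f z i \<le> score m f z j}} \<in> sets ?P" for i
  proof (cases "i \<in> {m+1..n+1}")
    case True
    then have "(\<lambda>z. score m f z i) \<in> borel_measurable ?P" by (rule score)
    with score[OF assms(3)] True show ?thesis
      by (simp only: mem_Collect_eq simp_thms) (rule borel_measurable_le)
  next
    case False
    then have "{z\<in>space ?P. i \<in> {i\<in>{m+1..n+1}. score m f z i \<le> score m f z j}} = {}"
      by blast
    then show ?thesis by (simp only: sets.empty_sets)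
  qed
  then show ?thesis unfolding score_rank_def by (rule measurable_card)
qed

section \<open>Exchangeability and uniformity of the test rank\<close>

context
  fixes M :: "'w measure" and Z :: "nat \<Rightarrow> 'w \<Rightarrow> (real^'p::finite) \<times> real"
    and n m :: nat and f :: "'p fitting"
  assumes M: "prob_space M"
    and exch: "exchangeable M (n + 1) Z"
    and fit: "measurable_fitting m f"
    and mn: "m \<le> n"
begin

lemma sample_measurable:
  assumes "\<pi> permutes {1..n+1}"
  shows "(\<lambda>\<omega>. \<lambda>i\<in>{1..n+1}. Z (\<pi> i) \<omega>) \<in> M \<rightarrow>\<^sub>M Pi\<^sub>M {1..n+1} (\<lambda>_. borel)"
  using exch permutes_in_image[OF assms] unfolding exchangeable_def
  by (intro measurable_restrict) auto

lemma score_rank_random: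
  assumes "j \<in> {m+1..n+1}"
  shows "(\<lambda>\<omega>. score_rank n m f (\<lambda>i. Z i \<omega>) j) \<in> M \<rightarrow>\<^sub>M count_space UNIV"
proof -
  have "(\<lambda>\<omega>. score_rank n m f (\<lambda>i\<in>{1..n+1}. Z i \<omega>) j) \<in> M \<rightarrow>\<^sub>M count_space UNIV"
    using measurable_compose[OF sample_measurable[OF permutes_id] score_rank_measurable[OF fit mn assms]]
    by simp
  then show ?thesis unfolding score_rank_restrict[OF mn assms] .
qed

text \<open>The transposition of \<open>j\<close> and \<open>n + 1\<close> fixes every training
  index. It therefore keeps the predictor and only permutes the scores, carrying the rank at
  \<open>j\<close> to the rank at \<open>n + 1\<close>.\<close>

lemma prob_score_rank_eq:
  assumes j: "j \<in> {m+1..n+1}"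
  shows "measure M {\<omega>\<in>space M. score_rank n m f (\<lambda>i. Z i \<omega>) j \<le> t} =
    measure M {\<omega>\<in>space M. score_rank n m f (\<lambda>i. Z i \<omega>) (n + 1) \<le> t}"
proof -
  define \<pi> where "\<pi> = Transposition.transpose j (n + 1)"
  have perm: "\<pi> permutes {1..n+1}" "\<pi> permutes {m+1..n+1}"
    using j unfolding \<pi>_def by (auto intro!: permutes_swap_id)
  let ?P = "Pi\<^sub>M {1..n+1} (\<lambda>_. borel) :: (nat \<Rightarrow> (real^'p) \<times> real) measure"
  let ?B = "{z\<in>space ?P. score_rank n m f z (n + 1) \<le> t}"
  have nA: "n + 1 \<in> {m+1..n+1}" using mn by simp
  have B: "?B \<in> sets ?P"
    using score_rank_measurable[OF fit mn nA] by measurable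
  \<comment> \<open>Exchangeability equates laws on the product space, so the event is read as the
    measurable set \<open>?B\<close> under each law.\<close>
  have law: "measure (distr M ?P (\<lambda>\<omega>. \<lambda>i\<in>{1..n+1}. Z (\<sigma> i) \<omega>)) ?B =
      measure M {\<omega>\<in>space M. score_rank n m f (\<lambda>i. Z (\<sigma> i) \<omega>) (n + 1) \<le> t}"
    if \<sigma>: "\<sigma> permutes {1..n+1}" for \<sigma>
    using measurable_space[OF sample_measurable[OF \<sigma>]]
    unfolding measure_distr[OF sample_measurable[OF \<sigma>] B]
    by (intro arg_cong[where f = "measure M"]) (auto simp only: score_rank_restrict[OF mn nA])
  have swap: "score_rank n m f (\<lambda>i. z (\<pi> i)) (n + 1) = score_rank n m f z j" for z
  proof -
    have "restrict (\<lambda>i. z (\<pi> i)) {1..m} = restrict z {1..m}"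
      using j mn by (auto simp: \<pi>_def Transposition.transpose_def restrict_def fun_eq_iff)
    then have s: "score m f (\<lambda>i. z (\<pi> i)) i = score m f z (\<pi> i)" for i
      by (simp add: score_def)
    have "bij_betw \<pi> {i\<in>{m+1..n+1}. score m f z (\<pi> i) \<le> score m f z j}
        {i\<in>{m+1..n+1}. score m f z i \<le> score m f z j}"
      using permutes_imp_bij[OF perm(2)] by (rule bij_betw_Collect) simp
    then show ?thesis
      unfolding score_rank_def s by (simp add: \<pi>_def bij_betw_same_card)
  qed
  have "distr M ?P (\<lambda>\<omega>. \<lambda>i\<in>{1..n+1}. Z (\<pi> i) \<omega>) = distr M ?P (\<lambda>\<omega>. \<lambda>i\<in>{1..n+1}. Z (id i) \<omega>)"
    using exch perm(1) unfolding exchangeable_def by simp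
  from law[OF permutes_id, unfolded this[symmetric] law[OF perm(1)]]
  show ?thesis by (simp only: swap[of "\<lambda>i. Z i _"] id_apply)
qed

text \<open>Double counting: almost surely exactly \<open>t\<close> indices have rank at most
  \<open>t\<close>, so the \<open>n - m + 1\<close> equal probabilities add up to
  \<open>t\<close>.\<close>

lemma prob_score_rank_le:
  assumes distinct: "scores_distinct n m f M Z"
    and t: "t \<le> n - m + 1"
  shows "measure M {\<omega>\<in>space M. score_rank n m f (\<lambda>i. Z i \<omega>) (n + 1) \<le> t} =
    real t / real (n - m + 1)"
proof -
  interpret prob_space M by (rule M)
  let ?A = "{m+1..n+1}"
  let ?E = "\<lambda>j. {\<omega>\<in>space M. score_rank n m f (\<lambda>i. Z i \<omega>) j \<le> t}"
  have E: "?E j \<in> events" if "j \<in> ?A" for j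
    using score_rank_random[OF that] by measurable
  have cardA: "card ?A = n - m + 1" using mn by simp
  have "(\<Sum>j\<in>?A. prob (?E j)) = (\<Sum>j\<in>?A. expectation (indicat_real (?E j)))"
    using E by (intro sum.cong) auto
  also have "\<dots> = expectation (\<lambda>\<omega>. \<Sum>j\<in>?A. indicat_real (?E j) \<omega>)"
    by (intro Bochner_Integration.integral_sum[symmetric] integrable_real_indicator E)
      (simp_all add: emeasure_eq_measure)
  also have "\<dots> = expectation (\<lambda>_. real t)"
  proof (rule integral_cong_AE)
    show "(\<lambda>\<omega>. \<Sum>j\<in>?A. indicat_real (?E j) \<omega>) \<in> borel_measurable M"
      using E by (intro borel_measurable_sum borel_measurable_indicator)
    show "AE \<omega> in M. (\<Sum>j\<in>?A. indicat_real (?E j) \<omega>) = real t"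
      using distinct[unfolded scores_distinct_def] AE_space
    proof eventually_elim
      case (elim \<omega>)
      have "(\<Sum>j\<in>?A. indicat_real (?E j) \<omega>) =
          (\<Sum>j\<in>?A. if score_rank n m f (\<lambda>i. Z i \<omega>) j \<le> t then 1 else 0)"
        using elim(2) by (intro sum.cong) (auto simp: indicator_def)
      also have "\<dots> = real (card {j\<in>?A. score_rank n m f (\<lambda>i. Z i \<omega>) j \<le> t})"
        by (subst sum.inter_filter[symmetric]) simp_all
      also have "\<dots> = real t"
        unfolding score_rank_def
        by (subst card_rank_le[OF _ elim(1)]) (simp_all only: cardA t finite_atLeastAtMost)
      finally show ?case .
    qed
  qed simp
  also have "\<dots> = real t" by (simp add: prob_space)
  finally have "(\<Sum>j\<in>?A. prob (?E j)) = real t" .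
  moreover have "(\<Sum>j\<in>?A. prob (?E j)) = (\<Sum>j\<in>?A. prob (?E (n + 1)))"
    by (intro sum.cong refl prob_score_rank_eq)
  ultimately have "prob (?E (n + 1)) * real (n - m + 1) = real t"
    by (simp only: sum_constant cardA mult.commute)
  moreover have nz: "real (n - m + 1) \<noteq> 0" by simp
  ultimately show ?thesis unfolding nonzero_eq_divide_eq[OF nz] by blast
qed

lemma eval_at_random:
  assumes "m < n" "1 \<le> K" "K \<le> n - m"
  shows "(\<lambda>\<omega>. eval_at n (quantile_matched n m K f) (\<lambda>i. Z i \<omega>)) \<in> borel_measurable M"
proof -
  have "n + 1 \<in> {m+1..n+1}" using mn by simp
  note [measurable] = score_rank_random[OF this]
  show ?thesis unfolding eval_at_quantile_matched[OF assms] by measurable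
qed

lemma cdf_eval_at_bound:
  assumes distinct: "scores_distinct n m f M Z"
    and par: "m < n" "1 \<le> K" "K \<le> n - m"
    and u: "0 \<le> u" "u \<le> 1"
  shows "\<bar>measure M {\<omega>\<in>space M. eval_at n (quantile_matched n m K f) (\<lambda>i. Z i \<omega>) \<le> u} - u\<bar>
    \<le> 1 / real K + 1 / real (n - m + 1)"
proof -
  obtain t where t: "t \<le> n - m + 1"
    "\<And>R. matched_level (n - m) K R \<le> u \<longleftrightarrow> R + 1 \<le> t"
    "\<bar>real t / real (n - m + 1) - u\<bar> \<le> 1 / real K + 1 / real (n - m + 1)"
    using matched_level_le_iff[OF par(2) u] by blast
  \<comment> \<open>Positivity makes the truncated subtraction exact: \<open>R + 1\<close> is the
    score rank for \<open>R\<close> equal to that rank minus 1.\<close>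
  have "score_rank n m f z (n + 1) > 0" for z
    unfolding score_rank_def using mn by (auto simp: card_gt_0_iff)
  then have "eval_at n (quantile_matched n m K f) z \<le> u \<longleftrightarrow> score_rank n m f z (n + 1) \<le> t" for z
    unfolding eval_at_quantile_matched[OF par] t(2) by (simp add: Suc_le_eq)
  then show ?thesis using prob_score_rank_le[OF distinct t(1)] t(3) by simp
qed

end

section \<open>Convergence in distribution and the uniform bound\<close>

lemma cdf_uniform_01: "cdf (uniform_measure lborel {0..1}) x = max 0 (min 1 (x::real))"
proof -
  have "measure lborel ({0..1} \<inter> {..x}) = max 0 (min 1 x)"
  proof (cases "x < 0")
    case True
    then have "{0..1} \<inter> {..x} = {}" by auto
    with True show ?thesis by simp
  next
    case False
    then have "{0..1} \<inter> {..x} = {0..min 1 x}" by auto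
    with False show ?thesis by simp
  qed
  then show ?thesis by (simp add: cdf_def measure_uniform_measure)
qed

theorem theorem6:
  fixes m K :: "nat \<Rightarrow> nat" and f :: "nat \<Rightarrow> 'p::finite fitting"
  assumes "\<And>n. n \<ge> 1 \<Longrightarrow> m n < n"
    and "\<And>n. n \<ge> 1 \<Longrightarrow> 1 \<le> K n"
    and "\<And>n. n \<ge> 1 \<Longrightarrow> K n < n - m n + 1"
    and "\<And>n. n \<ge> 1 \<Longrightarrow> measurable_fitting (m n) (f n)"
  shows "(filterlim (\<lambda>n. n - m n) at_top sequentially \<and> filterlim K at_top sequentially \<longrightarrow>
            asymptotic_predictive_system
              (\<lambda>n (M :: 'w measure) Z. scores_distinct n (m n) (f n) M Z)
              (\<lambda>n. quantile_matched n (m n) (K n) (f n))) \<and>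
         (\<forall>n\<ge>1. \<forall>(M :: 'w measure) Z.
            prob_space M \<and> exchangeable M (n + 1) Z \<and> scores_distinct n (m n) (f n) M Z \<longrightarrow>
            (SUP u\<in>{0<..<1}.
               \<bar>measure M {\<omega> \<in> space M.
                   eval_at n (quantile_matched n (m n) (K n) (f n)) (\<lambda>i. Z i \<omega>) \<le> u} - u\<bar>)
            \<le> 1 / real (K n) + 1 / real (n - m n + 1))"
proof (intro conjI impI allI)
  have par: "m n < n" "1 \<le> K n" "K n \<le> n - m n" "m n \<le> n" if "n \<ge> 1" for n
    using assms(1-3)[OF that] by auto
  {
    fix n and M :: "'w measure" and Z
    assume n: "n \<ge> 1"
      and A: "prob_space M \<and> exchangeable M (n + 1) Z \<and> scores_distinct n (m n) (f n) M Z"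
    show "(SUP u\<in>{0<..<1}. \<bar>measure M {\<omega> \<in> space M.
          eval_at n (quantile_matched n (m n) (K n) (f n)) (\<lambda>i. Z i \<omega>) \<le> u} - u\<bar>)
        \<le> 1 / real (K n) + 1 / real (n - m n + 1)"
    proof (rule cSUP_least)
      fix u :: real assume "u \<in> {0<..<1}"
      then show "\<bar>measure M {\<omega> \<in> space M.
          eval_at n (quantile_matched n (m n) (K n) (f n)) (\<lambda>i. Z i \<omega>) \<le> u} - u\<bar>
          \<le> 1 / real (K n) + 1 / real (n - m n + 1)"
        using A by (intro cdf_eval_at_bound par assms(4) n) simp_all
    qed simp
  next
    assume lim: "filterlim (\<lambda>n. n - m n) at_top sequentially \<and> filterlim K at_top sequentially"
    show "asymptotic_predictive_system
        (\<lambda>n (M :: 'w measure) Z. scores_distinct n (m n) (f n) M Z)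
        (\<lambda>n. quantile_matched n (m n) (K n) (f n))"
      unfolding asymptotic_predictive_system_def
    proof (intro conjI allI impI ballI)
      fix M :: "nat \<Rightarrow> 'w measure" and Z :: "nat \<Rightarrow> nat \<Rightarrow> 'w \<Rightarrow> (real^'p) \<times> real"
      assume A: "\<forall>n\<ge>1. prob_space (M n) \<and> exchangeable (M n) (n + 1) (Z n) \<and>
        scores_distinct n (m n) (f n) (M n) (Z n)"
      let ?Q = "\<lambda>n \<omega>. eval_at n (quantile_matched n (m n) (K n) (f n)) (\<lambda>i. Z n i \<omega>)"
      show meas: "?Q n \<in> borel_measurable (M n)" if "1 \<le> n" for n
        using A that by (intro eval_at_random par assms(4)) simp_all
      let ?F = "\<lambda>n. cdf (distr (M n) borel (?Q n))"
      have F: "?F n x = measure (M n) {\<omega>\<in>space (M n). ?Q n \<omega> \<le> x}" if "1 \<le> n" for n x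
        unfolding cdf_def using meas[OF that]
        by (subst measure_distr) (auto intro!: arg_cong[where f = "measure (M n)"])
      have Q01: "0 \<le> ?Q n \<omega>" "?Q n \<omega> \<le> 1" if "1 \<le> n" for n \<omega>
        using quantile_matched_predictive(1)[OF par(1-3)[OF that]] unfolding eval_at_def
        by (auto simp: image_subset_iff)
      \<comment> \<open>Convergence is shown at every real \<open>x\<close>. Outside
        \<open>{0..1}\<close> the distribution functions are exactly 0 or 1 for
        \<open>n \<ge> 1\<close>; inside, the finite-sample bound squeezes the error to 0.\<close>
      have "(\<lambda>n. ?F n x) \<longlonglongrightarrow> max 0 (min 1 x)" for x
      proof -
        consider "x < 0" | "1 < x" | "0 \<le> x" "x \<le> 1" by linarith
        then show ?thesis
        proof cases
          case 1
          have "?F n x = 0" if "1 \<le> n" for n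
          proof -
            have "{\<omega>\<in>space (M n). ?Q n \<omega> \<le> x} = {}"
              using Q01(1)[OF that] 1 by (auto simp: not_le intro: less_le_trans)
            then show ?thesis unfolding F[OF that] by (simp only: measure_empty)
          qed
          with 1 show ?thesis
            by (intro tendsto_eventually) (auto intro: eventually_sequentiallyI[of 1])
        next
          case 2
          have "?F n x = 1" if "1 \<le> n" for n
          proof -
            have "{\<omega>\<in>space (M n). ?Q n \<omega> \<le> x} = space (M n)"
              using order_trans[OF Q01(2)[OF that], of x] 2 by auto
            then show ?thesis using F[OF that] A that by (simp add: prob_space.prob_space)
          qed
          with 2 show ?thesis
            by (intro tendsto_eventually) (auto intro: eventually_sequentiallyI[of 1])
        next
          case 3
          have "(\<lambda>n. 1 / real (K n)) \<longlonglongrightarrow> 0" "(\<lambda>n. 1 / real (n - m n + 1)) \<longlonglongrightarrow> 0"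
            using filterlim_compose[OF lim_1_over_n[where 'a = real], of K]
              filterlim_compose[OF LIMSEQ_Suc[OF lim_1_over_n[where 'a = real]], of "\<lambda>n. n - m n"] lim
            by (simp_all add: o_def)
          then have lim0: "(\<lambda>n. 1 / real (K n) + 1 / real (n - m n + 1)) \<longlonglongrightarrow> 0"
            by (rule tendsto_add_zero)
          have "\<bar>?F n x - x\<bar> \<le> 1 / real (K n) + 1 / real (n - m n + 1)" if "1 \<le> n" for n
            unfolding F[OF that] using A that 3
            by (intro cdf_eval_at_bound par assms(4)) simp_all
          then have "eventually (\<lambda>n. norm (?F n x - x) \<le> 1 / real (K n) + 1 / real (n - m n + 1)) sequentially"
            unfolding real_norm_def by (rule eventually_sequentiallyI)
          then have "(\<lambda>n. ?F n x - x) \<longlonglongrightarrow> 0"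
            by (rule Lim_null_comparison[OF _ lim0])
          with 3 show ?thesis by (simp add: LIM_zero_iff)
        qed
      qed
      then show "weak_conv_m (\<lambda>n. distr (M n) borel (?Q n)) (uniform_measure lborel {0..1})"
        by (simp add: weak_conv_m_def weak_conv_def cdf_uniform_01)
    qed (intro quantile_matched_predictive par; assumption)+
  }
qed

end
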